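(* Let $G$ be a locally compact Abelian group. Suppose $\Omega_+ \subset G$ is an open $0$-symmetric neighborhood of $0$ satisfying the strict packing type condition with a translation set $\Lambda \subset G$: $$\Omega_+ \cap (\Lambda - \Lambda) = \{0\}.$$ Then $$\mathcal{D}(\Omega_+) \le \frac{1}{\overline{D}^{\#}(\Lambda)}.$$
   Context: $G$ is written additively and $m_G$ is a fixed Haar measure on $G$; all integrals over $G$ are with respect to $m_G$. A set $A\subset G$ is $0$-symmetric if $A=-A$. $\mathcal{B}_0$ is the class of Borel subsets of $G$ with compact closure. $A_1\Subset A_2$ means that $A_1$ is a compact subset of $A_2$. $\Lambda-\Lambda=\{\lambda-\lambda':\lambda,\lambda'\in\Lambda\}$. For $f:G\to\mathbb{R}$, $f_+=\max\{f,0\}$, $f_-=\max\{-f,0\}$, and $\operatorname{supp} f=\overline{\{x: f(x)\neq 0\}}$. $f\gg 0$ means that $f$ is positive definite: $\sum_{n,m=1}^N c_n\overline{c_m} f(x_n-x_m)\ge 0$ for all $N\in\mathbb{N}$, $x_1,\dots,x_N\in G$, $c_1,\dots,c_N\in\mathbb{C}$. For open sets $\Omega_+,\Omega_-\subset G$ let $\mathcal{F}_c(\Omega_+,\Omega_-)$ be the set of continuous real-valued $f$ on $G$ with $f\gg 0$, $f(0)=1$, $\operatorname{supp} f_+\Subset\Omega_+$, $\operatorname{supp} f_-\Subset\Omega_-$. The Delsarte constant is $$\mathcal{D}(\Omega_+) := \sup\Big\{\int_G f : f\in\mathcal{F}_c(\Omega_+,G)\Big\}$$ (supremum over the empty class is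 $0$). The asymptotic uniform upper density of a discrete set $\Lambda\subset G$ is $$\overline{D}^{\#}(\Lambda) := \inf_{C\Subset G}\ \sup_{V\in\mathcal{B}_0}\frac{\#(\Lambda\cap V)}{m_G(C+V)}.$$ Conventions: $a/0=+\infty$ for $a>0$, $0/0=0$ in the quotient in this definition, and $1/\overline{D}^{\#}(\Lambda)=+\infty$ if $\overline{D}^{\#}(\Lambda)=0$. *)

theory Defs
  imports "HOL-Analysis.Analysis"
begin

text \<open>
  Translation-invariant Radon measure that is not zero, on the Borel sets.  For groups that are
  not second countable both regularity conditions have to be required.
\<close>
definition haar_measure :: "'a::topological_ab_group_add measure \<Rightarrow> bool" where
  "haar_measure M \<longleftrightarrow>
     sets M = sets borel \<and>
     emeasure M UNIV \<noteq> 0 \<and>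
     (\<forall>x. \<forall>A\<in>sets borel. emeasure M ((\<lambda>y. x + y) ` A) = emeasure M A) \<and>
     (\<forall>K. compact K \<longrightarrow> emeasure M K < \<infinity>) \<and>
     (\<forall>A\<in>sets borel. emeasure M A = (INF U\<in>{U. open U \<and> A \<subseteq> U}. emeasure M U)) \<and>
     (\<forall>U. open U \<longrightarrow> emeasure M U = (SUP K\<in>{K. compact K \<and> K \<subseteq> U}. emeasure M K))"

definition positive_definite :: "('a::ab_group_add \<Rightarrow> real) \<Rightarrow> bool" where
  "positive_definite f \<longleftrightarrow>
     (\<forall>(N::nat) (x :: nat \<Rightarrow> 'a) (c :: nat \<Rightarrow> complex).
        (\<Sum>n=1..N. \<Sum>m=1..N. c n * cnj (c m) * of_real (f (x n - x m))) \<in> \<real>\<^sub>\<ge>\<^sub>0)"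

definition supp :: "('a::topological_space \<Rightarrow> real) \<Rightarrow> 'a set" where
  "supp f = closure {x. f x \<noteq> 0}"

definition admissible :: "'a::topological_ab_group_add set \<Rightarrow> 'a set \<Rightarrow> ('a \<Rightarrow> real) set" where
  "admissible \<Omega>p \<Omega>m =
     {f. continuous_on UNIV f \<and> positive_definite f \<and> f 0 = 1 \<and>
         compact (supp (\<lambda>x. max (f x) 0)) \<and> supp (\<lambda>x. max (f x) 0) \<subseteq> \<Omega>p \<and>
         compact (supp (\<lambda>x. max (- f x) 0)) \<and> supp (\<lambda>x. max (- f x) 0) \<subseteq> \<Omega>m}"

text \<open>The supremum over an empty class is 0 by convention; in \<^typ>\<open>ereal\<close> it would be \<open>-\<infinity>\<close>.\<close>
definition delsarte :: "'a::topological_ab_group_add measure \<Rightarrow> 'a set \<Rightarrow> ereal" where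
  "delsarte M \<Omega> =
     (if admissible \<Omega> UNIV = {} then 0
      else (SUP f\<in>admissible \<Omega> UNIV. ereal (\<integral>x. f x \<partial>M)))"

definition difference_set :: "'a::ab_group_add set \<Rightarrow> 'a set" where
  "difference_set \<Lambda> = {x - y | x y. x \<in> \<Lambda> \<and> y \<in> \<Lambda>}"

text \<open>
  The sum of a compact set and a Borel set need not be Borel, and \<^const>\<open>emeasure\<close> is 0
  outside the \<open>\<sigma>\<close>-algebra; so the measure of the sumset is taken as the outer measure, which
  agrees with the measure (and with its completion) wherever the latter is defined.
  Division in \<^typ>\<open>ennreal\<close> satisfies \<open>a / 0 = \<infinity>\<close> for \<open>a > 0\<close>, and \<open>0 / 0 = 0\<close>.
  Counting measure, unlike \<^const>\<open>card\<close>, is \<open>\<infinity>\<close> on infinite sets.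
\<close>
definition upper_density :: "'a::topological_ab_group_add measure \<Rightarrow> 'a set \<Rightarrow> ennreal" where
  "upper_density M \<Lambda> =
     (INF C\<in>{C. compact C}. SUP V\<in>{V. V \<in> sets borel \<and> compact (closure V)}.
        emeasure (count_space UNIV) (\<Lambda> \<inter> V) /
        outer_measure_of M (C + V))"

end

theory Submission
  imports Defs "HOL-Real_Asymp.Real_Asymp"
begin

text \<open>
  Let \<open>f\<close> be admissible with \<open>I = \<integral>f > 0\<close> and put \<open>L = \<integral>\<bar>f\<bar>\<close>. The packing condition makes
  \<open>f (\<lambda> - \<mu>) \<le> 0\<close> for distinct \<open>\<lambda>, \<mu> \<in> \<Lambda>\<close>, because the positive part of \<open>f\<close> lives in \<open>\<Omega>\<close>.
  Let \<open>S\<close> be a compact symmetric set containing all points where \<open>f\<close> does not vanish. For a compact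
  set \<open>K\<close>, a finite \<open>F \<subseteq> K \<inter> \<Lambda>\<close> and \<open>W = K + S\<close>, test positive definiteness of \<open>f\<close> on the signed
  measure consisting of a unit mass at each point of \<open>F\<close> minus \<open>1 / I\<close> times Haar measure on \<open>W\<close>.
  The point masses contribute at most \<open>card F\<close>, the mixed terms contribute exactly \<open>- 2 card F\<close>,
  and the term of \<open>W\<close> with itself is at most \<open>(I m(K) + L (m(W) - m(K))) / I\<^sup>2\<close>, since the inner
  integral equals \<open>I\<close> at points of \<open>K\<close> and is at most \<open>L\<close> elsewhere. This gives
  \<open>card F I\<^sup>2 \<le> I m(K) + L (m(W) - m(K))\<close> (lemma \<open>packing_in_compact\<close>).

  If \<open>K\<close> is a Folner set, that is \<open>m(K + S) \<le> (1 + \<delta>) m(K)\<close> with \<open>\<delta>\<close> small, the right hand side is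
  at most \<open>(1 + \<epsilon>) I m(K)\<close>. Such \<open>K\<close> are found among the iterated sumsets of \<open>S\<close>, whose measure
  grows only polynomially (lemma \<open>folner_compact\<close>). Averaging the local bound over all translates of
  \<open>K\<close> yields \<open>card F I \<le> (1 + \<epsilon>) m(F + K)\<close> for every finite \<open>F \<subseteq> \<Lambda>\<close>
  (lemma \<open>delsarte_packing_bound\<close>), and inserting \<open>C = K\<close> in the definition of the upper density
  shows that the density is at most \<open>(1 + \<epsilon>) / I\<close>.

  The group need not be second countable, so \<open>(x, y) \<mapsto> f (x - y)\<close> is not obviously measurable for
  the product \<open>\<sigma>\<close>-algebra, and \<open>m\<close> need not be \<open>\<sigma>\<close>-finite. Double integrals are therefore
  avoided: Haar measure on \<open>W\<close> is replaced by finitely many weighted points, one in each piece of a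
  Borel partition of \<open>W\<close> so fine that the resulting error tends to 0.
\<close>

section \<open>Translation invariance of Haar measure\<close>

lemma haar_borel_sets:
  assumes "haar_measure M" shows "sets M = sets borel"
  using assms unfolding haar_measure_def by (rule conjunct1)

lemma haar_space:
  assumes "haar_measure M" shows "space M = UNIV"
  using haar_borel_sets[OF assms] sets_eq_imp_space_eq by fastforce

lemma haar_compact_fmeasurable:
  fixes M :: "'a::{topological_ab_group_add, t2_space} measure"
  assumes "haar_measure M" "compact K"
  shows "K \<in> fmeasurable M"
proof (rule fmeasurableI)
  show "K \<in> sets M"
    using assms(2) haar_borel_sets[OF assms(1)] by (simp add: compact_imp_closed)
  show "emeasure M K < \<infinity>"
    using assms(1)[unfolded haar_measure_def, THEN conjunct2, THEN conjunct2, THEN conjunct2,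
      THEN conjunct1] assms(2) by simp
qed

lemma haar_emeasure_translate:
  assumes "haar_measure M" "A \<in> sets borel"
  shows "emeasure M ((+) x ` A) = emeasure M A"
  using assms(1)[unfolded haar_measure_def, THEN conjunct2, THEN conjunct2, THEN conjunct1]
    assms(2) by simp

lemma haar_measure_translate:
  assumes "haar_measure M" "A \<in> sets M"
  shows "measure M ((+) x ` A) = measure M A"
  using haar_emeasure_translate[OF assms(1), of A] assms(2) haar_borel_sets[OF assms(1)]
  by (simp add: measure_def)

lemma distr_translate:
  fixes M :: "'a::{topological_ab_group_add, t2_space} measure"
  assumes "haar_measure M"
  shows "distr M M ((+) x) = M"
proof (rule measure_eqI)
  fix A assume "A \<in> sets (distr M M ((+) x))"
  then have A: "A \<in> sets borel" using haar_borel_sets[OF assms] by simp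
  have meas: "(+) x \<in> measurable M M"
    unfolding measurable_cong_sets[OF haar_borel_sets[OF assms] haar_borel_sets[OF assms]]
    by (intro borel_measurable_continuous_onI continuous_intros)
  have "emeasure (distr M M ((+) x)) A = emeasure M ((+) x -` A \<inter> space M)"
    by (rule emeasure_distr[OF meas]) (simp only: A haar_borel_sets[OF assms])
  also have "(+) x -` A \<inter> space M = (+) (-x) ` A"
    unfolding haar_space[OF assms] by (force simp: image_iff)
  also have "emeasure M \<dots> = emeasure M A" by (rule haar_emeasure_translate[OF assms A])
  finally show "emeasure (distr M M ((+) x)) A = emeasure M A" .
qed simp

lemma haar_translate:
  fixes M :: "'a::{topological_ab_group_add, t2_space} measure" and g :: "'a \<Rightarrow> real"
  assumes "haar_measure M" "g \<in> borel_measurable M"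
  shows "integrable M (\<lambda>y. g (x + y)) = integrable M g"
    and "(\<integral>y. g (x + y) \<partial>M) = (\<integral>y. g y \<partial>M)"
proof -
  have meas: "(+) x \<in> measurable M M"
    unfolding measurable_cong_sets[OF haar_borel_sets[OF assms(1)] haar_borel_sets[OF assms(1)]]
    by (intro borel_measurable_continuous_onI continuous_intros)
  show "integrable M (\<lambda>y. g (x + y)) = integrable M g"
    using integrable_distr_eq[OF meas assms(2)] by (simp add: distr_translate[OF assms(1)])
  show "(\<integral>y. g (x + y) \<partial>M) = (\<integral>y. g y \<partial>M)"
    using integral_distr[OF meas assms(2)] by (simp add: distr_translate[OF assms(1)])
qed

section \<open>Growth of iterated sumsets and Folner sets\<close>

lemma compact_set_plus:
  fixes K S :: "'a::topological_ab_group_add set"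
  assumes "compact K" "compact S"
  shows "compact (K + S)"
proof -
  have "K + S = (\<lambda>p. fst p + snd p) ` (K \<times> S)"
    by (force simp: set_plus_def image_iff)
  then show ?thesis
    using assms by (auto intro!: compact_continuous_image continuous_intros compact_Times)
qed

lemma compact_uminus_image:
  fixes K :: "'a::topological_ab_group_add set"
  assumes "compact K"
  shows "compact (uminus ` K)"
  using assms by (auto intro!: compact_continuous_image continuous_intros)

text \<open>
  Sums of elements of \<open>A\<close> in which every element occurs at most \<open>n\<close> times; \<open>k a\<close> is the
  multiplicity of \<open>a\<close>, and the inner sum is the \<open>k a\<close>-fold multiple of \<open>a\<close> in the additive group.
  All \<open>n\<close>-fold sums over \<open>A\<close> are of this form, and by commutativity there are only polynomially
  many of them in \<open>n\<close>.
\<close>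
definition multiset_sums :: "'a::ab_group_add set \<Rightarrow> nat \<Rightarrow> 'a set" where
  "multiset_sums A n = (\<lambda>k. \<Sum>a\<in>A. \<Sum>i<k a. a) ` (A \<rightarrow>\<^sub>E {..n::nat})"

lemma multiset_sums_card:
  assumes "finite A"
  shows "finite (multiset_sums A n)" "card (multiset_sums A n) \<le> (n + 1) ^ card A"
proof -
  have fin: "finite (A \<rightarrow>\<^sub>E {..n})" using assms by (intro finite_PiE) auto
  then show "finite (multiset_sums A n)" by (simp add: multiset_sums_def)
  have "card (multiset_sums A n) \<le> card (A \<rightarrow>\<^sub>E {..n})"
    unfolding multiset_sums_def using fin by (rule card_image_le)
  also have "\<dots> = (n + 1) ^ card A" using assms by (simp add: card_PiE)
  finally show "card (multiset_sums A n) \<le> (n + 1) ^ card A" .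
qed

lemma multiset_sums_zero: "0 \<in> multiset_sums A n"
  unfolding multiset_sums_def
  by (rule image_eqI[where x = "\<lambda>a\<in>A. 0"]) auto

lemma multiset_sums_Suc:
  assumes "finite A" "b \<in> multiset_sums A n" "a \<in> A"
  shows "b + a \<in> multiset_sums A (Suc n)"
proof -
  obtain k where k: "k \<in> A \<rightarrow>\<^sub>E {..n}" "b = (\<Sum>a\<in>A. \<Sum>i<k a. a)"
    using assms(2) by (auto simp: multiset_sums_def)
  let ?k = "k(a := Suc (k a))"
  have "(\<Sum>c\<in>A. \<Sum>i<?k c. c) = (\<Sum>i<Suc (k a). a) + (\<Sum>c\<in>A - {a}. \<Sum>i<k c. c)"
    by (subst sum.remove[OF assms(1,3)]) auto
  also have "\<dots> = b + a"
    unfolding k(2) sum.remove[OF assms(1,3), of "\<lambda>a. \<Sum>i<k a. a"]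
    by (simp add: algebra_simps)
  finally have "b + a = (\<Sum>c\<in>A. \<Sum>i<?k c. c)" ..
  moreover have "?k \<in> A \<rightarrow>\<^sub>E {..Suc n}"
    using k(1) assms(3) by (auto simp: PiE_iff extensional_def le_Suc_eq)
  ultimately show ?thesis unfolding multiset_sums_def by blast
qed

text \<open>
  The set \<open>((+) S ^^ n) S\<close> is the sum of \<open>n + 1\<close> copies of \<open>S\<close>. One covering of \<open>S + S\<close> by
  translates of \<open>S\<close> propagates to a covering of all iterated sumsets.
\<close>
lemma sumset_power_cover:
  fixes S :: "'a::ab_group_add set"
  assumes "finite A" "S + S \<subseteq> A + S"
  shows "((+) S ^^ n) S \<subseteq> multiset_sums A n + S"
proof (induction n)
  case 0
  show ?case using set_zero_plus2[OF multiset_sums_zero[of A 0]] by simp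
next
  case (Suc n)
  show ?case
  proof
    fix x assume "x \<in> ((+) S ^^ Suc n) S"
    then obtain s y where x: "x = s + y" "s \<in> S" "y \<in> ((+) S ^^ n) S"
      by (auto elim: set_plus_elim)
    then obtain b s' where y: "y = b + s'" "b \<in> multiset_sums A n" "s' \<in> S"
      using Suc.IH by (blast elim: set_plus_elim)
    have "s + s' \<in> A + S" using x y assms(2) by blast
    then obtain a s'' where a: "s + s' = a + s''" "a \<in> A" "s'' \<in> S"
      by (auto elim: set_plus_elim)
    have "x = (b + a) + s''" using x y a(1) by (simp add: algebra_simps) 
    then show "x \<in> multiset_sums A (Suc n) + S"
      using multiset_sums_Suc[OF assms(1) y(2) a(2)] a(3) by auto
  qed
qed

lemma compact_sumset_power:
  fixes S :: "'a::topological_ab_group_add set"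
  assumes "compact S"
  shows "compact (((+) S ^^ n) S)"
  by (induction n) (auto intro: assms compact_set_plus)

lemma uminus_sumset_power:
  fixes S :: "'a::ab_group_add set"
  assumes "uminus ` S = S"
  shows "uminus ` ((+) S ^^ n) S = ((+) S ^^ n) S"
proof (induction n)
  case (Suc n)
  have "uminus ` (A + B) = uminus ` A + uminus ` B" for A B :: "'a set"
    by (force simp: set_plus_def image_iff)
  then show ?case using Suc assms by simp
qed (use assms in simp)

lemma sumset_power_mono:
  fixes S :: "'a::ab_group_add set"
  assumes "0 \<in> S"
  shows "S \<subseteq> ((+) S ^^ n) S"
proof (induction n)
  case (Suc n)
  then show ?case using set_zero_plus2[OF assms] by auto
qed simp

lemma compact_covered_by_translates:
  fixes S K :: "'a::topological_ab_group_add set"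
  assumes "compact K" "0 \<in> interior S"
  obtains A where "finite A" "K \<subseteq> A + S"
proof -
  have op: "open ((\<lambda>y. y - a) -` interior S)" for a
    by (intro open_vimage continuous_intros) auto
  obtain A where A: "A \<subseteq> K" "finite A" "K \<subseteq> (\<Union>a\<in>A. (\<lambda>y. y - a) -` interior S)"
    by (rule compactE_image[OF assms(1), of K "\<lambda>a. (\<lambda>y. y - a) -` interior S"])
      (use op assms(2) in auto)
  have "K \<subseteq> A + S"
  proof
    fix x assume "x \<in> K"
    then obtain a where "a \<in> A" "x - a \<in> S" using A interior_subset by blast
    then have "a + (x - a) \<in> A + S" by (rule set_plus_intro)
    then show "x \<in> A + S" by simp
  qed
  with A show ?thesis using that by blast
qed

text \<open>
  If the measures of the iterated sumsets of \<open>S\<close> grew by a factor \<open>1 + \<delta>\<close> in each step, they would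
  grow exponentially, contradicting the polynomial
  bound from \<open>sumset_power_cover\<close> and \<open>multiset_sums_card\<close>.
\<close>
lemma folner_compact:
  fixes M :: "'a::{topological_ab_group_add, t2_space} measure"
  assumes M: "haar_measure M" and S: "compact S" "0 \<in> interior S" "uminus ` S = S"
    and pos: "measure M S > 0" and "\<delta> > 0"
  obtains K where "compact K" "uminus ` K = K" "measure M K > 0" "S \<subseteq> K"
    "measure M (K + S) \<le> (1 + \<delta>) * measure M K"
proof -
  define K where "K n = ((+) S ^^ n) S" for n
  have S0: "0 \<in> S" using S(2) interior_subset by blast
  have cK: "compact (K n)" for n unfolding K_def by (rule compact_sumset_power[OF S(1)])
  have SK: "S \<subseteq> K n" for n unfolding K_def by (rule sumset_power_mono[OF S0])
  have fm: "K n \<in> fmeasurable M" for n by (rule haar_compact_fmeasurable[OF M cK])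
  have posK: "measure M (K n) > 0" for n
    using measure_mono_fmeasurable[OF SK _ fm, of n] haar_compact_fmeasurable[OF M S(1)] pos
    by (simp add: fmeasurableD)
  have "\<exists>n. measure M (K n + S) \<le> (1 + \<delta>) * measure M (K n)"
  proof (rule ccontr)
    assume "\<nexists>n. measure M (K n + S) \<le> (1 + \<delta>) * measure M (K n)"
    then have grow: "(1 + \<delta>) * measure M (K n) < measure M (K (Suc n))" for n
      by (simp add: K_def add.commute not_le)
    have low: "(1 + \<delta>) ^ n * measure M S \<le> measure M (K n)" for n
    proof (induction n)
      case (Suc n)
      have "(1 + \<delta>) ^ Suc n * measure M S \<le> (1 + \<delta>) * measure M (K n)"
        using Suc \<open>\<delta> > 0\<close> by simp
      with grow[of n] show ?case by linarith
    qed (simp add: K_def)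
    obtain A where A: "finite A" "S + S \<subseteq> A + S"
      using compact_covered_by_translates[OF compact_set_plus[OF S(1) S(1)] S(2)] by blast
    have up: "measure M (K n) \<le> real (n + 1) ^ card A * measure M S" for n
    proof -
      let ?B = "multiset_sums A n"
      have eq: "?B + S = (\<Union>b\<in>?B. (+) b ` S)" by (auto simp: set_plus_def)
      have cpt: "compact ((+) b ` S)" for b
        by (intro compact_continuous_image continuous_intros S(1))
      have "compact (?B + S)"
        unfolding eq using cpt multiset_sums_card(1)[OF A(1)] by (intro compact_UN) auto
      then have "measure M (K n) \<le> measure M (?B + S)"
        using sumset_power_cover[OF A] fm haar_compact_fmeasurable[OF M]
        by (intro measure_mono_fmeasurable) (auto simp: K_def)
      also have "\<dots> \<le> (\<Sum>b\<in>?B. measure M ((+) b ` S))"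
        unfolding eq using cpt haar_compact_fmeasurable[OF M] multiset_sums_card(1)[OF A(1)]
        by (intro measure_UNION_le) auto
      also have "\<dots> = real (card ?B) * measure M S"
        using haar_measure_translate[OF M] haar_compact_fmeasurable[OF M S(1)] by simp
      also have "\<dots> \<le> real ((n + 1) ^ card A) * measure M S"
      proof (rule mult_right_mono)
        show "real (card ?B) \<le> real ((n + 1) ^ card A)"
          using multiset_sums_card(2)[OF A(1)] of_nat_le_iff by blast
      qed simp
      finally show ?thesis by simp
    qed
    have "1 \<le> real (n + 1) ^ card A / (1 + \<delta>) ^ n" for n
    proof -
      have "(1 + \<delta>) ^ n * measure M S \<le> real (n + 1) ^ card A * measure M S"
        using low[of n] up[of n] by linarith
      with pos \<open>\<delta> > 0\<close> show ?thesis by (simp add: le_divide_eq)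
    qed
    moreover have "(\<lambda>n. real (n + 1) ^ card A / (1 + \<delta>) ^ n) \<longlonglongrightarrow> 0"
      using \<open>\<delta> > 0\<close> by real_asymp
    ultimately have "(1::real) \<le> 0" by (intro LIMSEQ_le_const) auto
    then show False by simp
  qed
  then obtain n where "measure M (K n + S) \<le> (1 + \<delta>) * measure M (K n)" ..
  with cK posK SK uminus_sumset_power[OF S(3)] show ?thesis
    by (intro that[of "K n"]) (auto simp: K_def)
qed

section \<open>Positive definite functions\<close>

lemma positive_definite_form_nonneg:
  fixes c :: "'i \<Rightarrow> real" and x :: "'i \<Rightarrow> 'a::ab_group_add"
  assumes "positive_definite f" "finite J"
  shows "0 \<le> (\<Sum>i\<in>J. \<Sum>j\<in>J. c i * c j * f (x i - x j))"
proof -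
  obtain h where h: "bij_betw h {1..card J} J"
    using ex_bij_betw_nat_finite_1[OF assms(2)] by blast
  have "(\<Sum>i\<in>J. \<Sum>j\<in>J. c i * c j * f (x i - x j))
      = (\<Sum>n=1..card J. \<Sum>m=1..card J. c (h n) * c (h m) * f (x (h n) - x (h m)))"
    by (simp add: sum.reindex_bij_betw[OF h, symmetric])
  also have "complex_of_real \<dots> = (\<Sum>n=1..card J. \<Sum>m=1..card J.
      complex_of_real (c (h n)) * cnj (complex_of_real (c (h m))) * of_real (f (x (h n) - x (h m))))"
    by simp
  also have "\<dots> \<in> \<real>\<^sub>\<ge>\<^sub>0"
    using assms(1)[unfolded positive_definite_def, rule_format,
      of "\<lambda>n. complex_of_real (c (h n))" "\<lambda>n. x (h n)" "card J"] by simp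
  finally show ?thesis by (simp add: complex_nonneg_Reals_iff)
qed

text \<open>
  Evaluated at the points \<open>x, 0\<close> with coefficients \<open>1, \<i>\<close>, the quadratic form has imaginary part
  \<open>f (- x) - f x\<close>.
\<close>
lemma positive_definite_even:
  assumes "positive_definite f"
  shows "f (- x) = f x"
proof -
  have two: "{1..2::nat} = {1, 2}" by auto
  have "(\<Sum>n=1..2::nat. \<Sum>m=1..2::nat. (if n = 1 then 1 else \<i>) * cnj (if m = 1 then 1 else \<i>)
      * of_real (f ((if n = 1 then x else 0) - (if m = 1 then x else 0)))) \<in> \<real>\<^sub>\<ge>\<^sub>0"
    using assms[unfolded positive_definite_def, rule_format,
      of "\<lambda>n. if n = 1 then 1 else \<i>" "\<lambda>n. if n = 1 then x else 0" 2] by simp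
  then show ?thesis unfolding two by (simp add: complex_nonneg_Reals_iff)
qed

section \<open>Riemann sums over compact sets\<close>

text \<open>
  The oscillation bound is uniform in the translation parameter \<open>x \<in> W\<close>. Each piece is also either
  contained in \<open>K\<close> or disjoint from it, so that its sample point \<open>a A\<close> lies in \<open>K\<close> exactly when
  the piece does.
\<close>
lemma finite_borel_partition:
  fixes f :: "'a::{topological_ab_group_add, t2_space} \<Rightarrow> real"
  assumes f: "continuous_on UNIV f" and W: "compact W" and K: "K \<in> sets borel" and "\<eta> > 0"
  obtains P a where "finite P" "disjoint P" "\<Union>P = W"
    "\<And>A. A \<in> P \<Longrightarrow> A \<in> sets borel" "\<And>A. A \<in> P \<Longrightarrow> a A \<in> A"
    "\<And>A. A \<in> P \<Longrightarrow> A \<subseteq> K \<or> A \<inter> K = {}"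
    "\<And>A x y. A \<in> P \<Longrightarrow> x \<in> W \<Longrightarrow> y \<in> A \<Longrightarrow> \<bar>f (x - y) - f (x - a A)\<bar> \<le> \<eta>"
proof -
  have "\<exists>U. y \<in> U \<and> open U \<and> (\<forall>z\<in>U. \<forall>x\<in>W. \<bar>f (x - z) - f (x - y)\<bar> < \<eta> / 2)" for y
  proof -
    let ?T = "{p. \<bar>f (snd p - fst p) - f (snd p - y)\<bar> < \<eta> / 2}"
    have T: "open ?T"
      by (intro open_Collect_less continuous_intros continuous_on_compose2[OF f]) auto
    have yT: "{y} \<times> W \<subseteq> ?T" using \<open>\<eta> > 0\<close> by auto
    obtain U where U: "y \<in> U" "open U" "U \<times> W \<subseteq> ?T"
      using Elementary_Topology.tube_lemma[OF W T yT] by (elim exE conjE) (rule that)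
    have "\<bar>f (x - z) - f (x - y)\<bar> < \<eta> / 2" if "z \<in> U" "x \<in> W" for x z
      using subsetD[OF U(3), of "(z, x)"] that by simp
    with U(1,2) show ?thesis by (intro exI[of _ U] conjI ballI)
  qed
  then obtain U where U: "\<And>y. y \<in> U y" "\<And>y. open (U y)"
    "\<And>y z x. z \<in> U y \<Longrightarrow> x \<in> W \<Longrightarrow> \<bar>f (x - z) - f (x - y)\<bar> < \<eta> / 2"
    by metis
  obtain T where T: "T \<subseteq> W" "finite T" "W \<subseteq> (\<Union>t\<in>T. U t)"
    by (rule compactE_image[OF W, of W U]) (use U in auto)
  \<comment> \<open>Points belong to the same piece if they lie in the same sets of the finite cover and on the
    same side of \<open>K\<close>.\<close>
  define s where "s y = ({t \<in> T. y \<in> U t}, y \<in> K)" for y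
  define piece where "piece y = {z \<in> W. s z = s y}" for y
  define P where "P = piece ` W"
  define a where "a A = (SOME y. y \<in> A)" for A :: "'a set"
  have "finite (s ` W)"
    by (rule finite_subset[of _ "Pow T \<times> UNIV"]) (use T(2) in \<open>auto simp: s_def\<close>)
  moreover have "P = (\<lambda>v. {z \<in> W. s z = v}) ` s ` W" by (auto simp: P_def piece_def)
  ultimately have fin: "finite P" by simp
  have dis: "disjoint P" by (auto simp: disjoint_def P_def piece_def)
  have un: "\<Union>P = W" by (auto simp: P_def piece_def)
  have bor: "A \<in> sets borel" if A: "A \<in> P" for A
  proof -
    obtain y where "A = piece y" using A unfolding P_def by blast
    then have eq: "A = W \<inter> (if y \<in> K then K else - K) \<inter> {z. \<forall>t\<in>T. z \<in> (if y \<in> U t then U t else - U t)}"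
      by (auto simp: piece_def s_def)
    have "{z \<in> space borel. \<forall>t\<in>T. z \<in> (if y \<in> U t then U t else - U t)} \<in> sets borel"
    proof (rule sets.sets_Collect_finite_All)
      fix t
      have "(if y \<in> U t then U t else - U t) \<in> sets borel" using U(2) by (simp add: borel_comp)
      then show "{z \<in> space borel. z \<in> (if y \<in> U t then U t else - U t)} \<in> sets borel"
        by (simp only: space_borel UNIV_I simp_thms Collect_mem_eq)
    qed (fact T(2))
    then show ?thesis
      unfolding eq using K W by (intro sets.Int) (auto simp: compact_imp_closed borel_comp)
  qed
  have aA: "a A \<in> A" if "A \<in> P" for A
  proof -
    have "A \<noteq> {}" using that by (auto simp: P_def piece_def)
    then show ?thesis by (simp add: a_def some_in_eq)
  qed
  have KA: "A \<subseteq> K \<or> A \<inter> K = {}" if "A \<in> P" for A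
    using that by (auto simp: P_def piece_def s_def)
  have osc: "\<bar>f (x - y) - f (x - a A)\<bar> \<le> \<eta>" if "A \<in> P" "x \<in> W" "y \<in> A" for A x y
  proof -
    have yA: "y \<in> W" "a A \<in> W" "s y = s (a A)"
      using that aA[OF that(1)] by (auto simp: P_def piece_def)
    then obtain t where t: "t \<in> T" "y \<in> U t" using T(3) by blast
    with yA(3) have "a A \<in> U t" by (auto simp: s_def)
    with U(3)[OF t(2) that(2)] U(3)[OF this that(2)] show ?thesis by linarith
  qed
  show ?thesis by (rule that[OF fin dis un bor aA KA osc])
qed

lemma sum_measure_partition:
  assumes "finite P" "disjoint P" "\<And>A. A \<in> P \<Longrightarrow> A \<in> fmeasurable M"
  shows "measure M (\<Union>P) = (\<Sum>A\<in>P. measure M A)"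
proof -
  have "measure M (\<Union>A\<in>P. A) = (\<Sum>A\<in>P. measure M A)"
  proof (rule measure_finite_Union[OF assms(1)])
    show "disjoint_family_on (\<lambda>A. A) P"
      using assms(2) by (auto simp: disjoint_family_on_def disjoint_def)
  qed (use assms(3) in \<open>auto simp: fmeasurable_def less_top[symmetric]\<close>)
  then show ?thesis by simp
qed

lemma integral_Riemann_sum:
  fixes g :: "'a \<Rightarrow> real"
  assumes P: "finite P" "disjoint P" "\<And>A. A \<in> P \<Longrightarrow> A \<in> fmeasurable M" and g: "integrable M g"
    and osc: "\<And>A y. A \<in> P \<Longrightarrow> y \<in> A \<Longrightarrow> \<bar>g y - v A\<bar> \<le> \<eta>"
  shows "\<bar>(\<integral>y. indicator (\<Union>P) y * g y \<partial>M) - (\<Sum>A\<in>P. measure M A * v A)\<bar> \<le> \<eta> * measure M (\<Union>P)"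
proof -
  let ?h = "\<lambda>y. \<Sum>A\<in>P. indicat_real A y * v A"
  have W: "\<Union>P \<in> fmeasurable M" using P(1,3) by (intro fmeasurable.finite_Union) auto
  have ind: "integrable M (indicat_real A)" if "A \<in> P" for A
    using P(3)[OF that] by (intro integrable_real_indicator) (auto simp: fmeasurable_def)
  have h: "integrable M ?h" using ind by (intro Bochner_Integration.integrable_sum) simp
  have "(\<integral>y. ?h y \<partial>M) = (\<Sum>A\<in>P. measure M A * v A)"
    using ind P(3) by (subst Bochner_Integration.integral_sum) (auto intro!: sum.cong simp: fmeasurableD)
  moreover have gW: "integrable M (\<lambda>y. indicat_real (\<Union>P) y * g y)"
    using integrable_mult_indicator[OF fmeasurableD[OF W] g] by simp
  ultimately have "(\<integral>y. indicator (\<Union>P) y * g y \<partial>M) - (\<Sum>A\<in>P. measure M A * v A)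
      = (\<integral>y. indicator (\<Union>P) y * g y - ?h y \<partial>M)"
    using h by simp
  also have "\<bar>\<dots>\<bar> \<le> (\<integral>y. \<bar>indicator (\<Union>P) y * g y - ?h y\<bar> \<partial>M)"
    by (rule integral_abs_bound)
  also have "\<dots> \<le> (\<integral>y. \<eta> * indicator (\<Union>P) y \<partial>M)"
  proof (rule integral_mono)
    show "integrable M (\<lambda>y. \<bar>indicator (\<Union>P) y * g y - ?h y\<bar>)"
      using gW h by (intro integrable_abs Bochner_Integration.integrable_diff)
    show "integrable M (\<lambda>y. \<eta> * indicat_real (\<Union>P) y)"
      using W by (intro integrable_mult_right integrable_real_indicator) (auto simp: fmeasurable_def)
    fix y
    show "\<bar>indicator (\<Union>P) y * g y - ?h y\<bar> \<le> \<eta> * indicator (\<Union>P) y"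
    proof (cases "y \<in> \<Union>P")
      case True
      then obtain A where A: "A \<in> P" "y \<in> A" by blast
      have "?h y = (\<Sum>B\<in>P. if B = A then v B else 0)"
        using A P(2) by (intro sum.cong) (auto simp: indicator_def disjoint_def)
      also have "\<dots> = v A" using A(1) P(1) by simp
      finally show ?thesis using True osc[OF A] by simp
    next
      case False
      then have "?h y = 0" by (intro sum.neutral) auto
      then show ?thesis using False by simp
    qed
  qed
  also have "\<dots> = \<eta> * measure M (\<Union>P)" using W by (simp add: fmeasurableD)
  finally show ?thesis .
qed

lemma integrable_continuous_compact_support:
  fixes M :: "'a::{topological_ab_group_add, t2_space} measure" and f :: "'a \<Rightarrow> real"
  assumes M: "haar_measure M" and f: "continuous_on UNIV f" and S: "compact S" "{x. f x \<noteq> 0} \<subseteq> S"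
  shows "integrable M f"
proof -
  have "bounded (f ` S)"
    using S(1) by (intro compact_imp_bounded compact_continuous_image continuous_on_subset[OF f]) auto
  then obtain b where b: "\<And>x. x \<in> S \<Longrightarrow> \<bar>f x\<bar> \<le> b" by (auto simp: bounded_iff)
  have meas: "f \<in> borel_measurable M"
    unfolding measurable_cong_sets[OF haar_borel_sets[OF M] refl]
    by (rule borel_measurable_continuous_onI[OF f])
  have "integrable M (\<lambda>x. b * indicat_real S x)"
    using haar_compact_fmeasurable[OF M S(1)]
    by (intro integrable_mult_right integrable_real_indicator) (auto simp: fmeasurable_def)
  then show ?thesis
    by (rule Bochner_Integration.integrable_bound[OF _ meas], intro AE_I2)
      (use b S(2) in \<open>force simp: indicator_def\<close>)
qed

section \<open>Packings inside a compact set\<close>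

lemma packing_in_compact:
  fixes M :: "'a::{topological_ab_group_add, t2_space} measure" and f :: "'a \<Rightarrow> real"
  assumes M: "haar_measure M" and f: "continuous_on UNIV f" "positive_definite f" "f 0 = 1"
    and S: "compact S" "0 \<in> S" "{x. f x \<noteq> 0} \<subseteq> S" and K: "compact K"
    and F: "finite F" "F \<subseteq> K" "\<And>x y. x \<in> F \<Longrightarrow> y \<in> F \<Longrightarrow> x \<noteq> y \<Longrightarrow> f (x - y) \<le> 0"
    and pos: "(\<integral>x. f x \<partial>M) > 0"
  shows "card F * (\<integral>x. f x \<partial>M)\<^sup>2
    \<le> (\<integral>x. f x \<partial>M) * measure M K + (\<integral>x. \<bar>f x\<bar> \<partial>M) * (measure M (K + S) - measure M K)"
proof -
  define W where "W = K + S"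
  define w where "w = measure M W"
  define k where "k = measure M K"
  define I where "I = (\<integral>x. f x \<partial>M)"
  define L where "L = (\<integral>x. \<bar>f x\<bar> \<partial>M)"
  define N where "N = real (card F)"
  have int: "integrable M f" by (rule integrable_continuous_compact_support[OF M f(1) S(1,3)])
  have meas: "f \<in> borel_measurable M" using int by simp
  have cW: "compact W" unfolding W_def by (rule compact_set_plus[OF K S(1)])
  have KW: "K \<subseteq> W" using set_zero_plus2[OF S(2), of K] by (simp add: W_def add.commute)
  have even: "f (x - y) = f (y - x)" for x y
    using positive_definite_even[OF f(2), of "y - x"] by simp
  have flip: "f (x - y) = f (- x + y)" for x y
    using even[of x y] by simp
  have int_x: "integrable M (\<lambda>y. f (x - y))" for x
    unfolding flip haar_translate(1)[OF M meas] by (rule int)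
  have fW: "W \<in> fmeasurable M" by (rule haar_compact_fmeasurable[OF M cW])
  define r where "r x = (\<integral>y. indicator W y * f (x - y) \<partial>M)" for x
  have rK: "r x = I" if "x \<in> K" for x
  proof -
    have "indicator W y * f (x - y) = f (- x + y)" for y
    proof (cases "y \<in> W")
      case False
      have "- x + y \<notin> S"
      proof
        assume "- x + y \<in> S"
        with that have "x + (- x + y) \<in> K + S" by (rule set_plus_intro)
        with False show False by (simp add: W_def)
      qed
      with False S(3) show ?thesis by auto
    next
      case True
      then have "indicator W y = (1::real)" by simp
      then show ?thesis by (simp only: flip mult_1_left)
    qed
    then have "r x = (\<integral>y. f (- x + y) \<partial>M)" by (simp only: r_def)
    also have "\<dots> = I" unfolding I_def by (rule haar_translate(2)[OF M meas])
    finally show ?thesis .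
  qed
  have rL: "r x \<le> L" for x
  proof -
    have "r x \<le> (\<integral>y. \<bar>f (- x + y)\<bar> \<partial>M)"
      unfolding r_def
    proof (rule integral_mono)
      show "integrable M (\<lambda>y. indicator W y * f (x - y))"
        using integrable_mult_indicator[OF fmeasurableD[OF fW] int_x] by simp
      show "integrable M (\<lambda>y. \<bar>f (- x + y)\<bar>)"
        using int_x[of x] unfolding flip by (rule integrable_abs)
      show "indicator W y * f (x - y) \<le> \<bar>f (- x + y)\<bar>" for y
        unfolding flip by (auto simp: indicator_def)
    qed
    also have "\<dots> = L"
      unfolding L_def by (rule haar_translate(2)[OF M]) (use meas in simp)
    finally show ?thesis .
  qed
  \<comment> \<open>The bound up to the error of a partition with oscillation at most \<open>\<eta>\<close>.\<close>
  have approx: "N * I\<^sup>2 \<le> I * k + L * (w - k) + \<eta> * (2 * N * I * w + w\<^sup>2)" if \<eta>: "\<eta> > 0" for \<eta>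
  proof -
    have borel_K: "K \<in> sets borel" using K by (simp add: compact_imp_closed)
    obtain P a where P: "finite P" "disjoint P" "\<Union>P = W"
      "\<And>A. A \<in> P \<Longrightarrow> A \<in> sets borel" "\<And>A. A \<in> P \<Longrightarrow> a A \<in> A"
      "\<And>A. A \<in> P \<Longrightarrow> A \<subseteq> K \<or> A \<inter> K = {}"
      "\<And>A x y. A \<in> P \<Longrightarrow> x \<in> W \<Longrightarrow> y \<in> A \<Longrightarrow> \<bar>f (x - y) - f (x - a A)\<bar> \<le> \<eta>"
      by (rule finite_borel_partition[OF f(1) cW borel_K \<eta>]) (rule that)
    have fm: "A \<in> fmeasurable M" if "A \<in> P" for A
      using fmeasurableI2[OF fW, of A] P(3) P(4)[OF that] that haar_borel_sets[OF M] by auto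
    let ?m = "measure M"
    define s where "s x = (\<Sum>A\<in>P. ?m A * f (x - a A))" for x
    have rs: "\<bar>r x - s x\<bar> \<le> \<eta> * w" if "x \<in> W" for x
      unfolding r_def s_def w_def P(3)[symmetric]
      by (rule integral_Riemann_sum[OF P(1,2) fm int_x P(7)[OF _ that]])
    have sum_w: "(\<Sum>A\<in>P. ?m A) = w"
      using sum_measure_partition[OF P(1,2) fm] by (simp add: P(3) w_def)
    have sum_k: "(\<Sum>A\<in>{A\<in>P. A \<subseteq> K}. ?m A) = k"
    proof -
      have "K = \<Union>{A\<in>P. A \<subseteq> K}"
        using P(3,6) KW by blast
      moreover have "?m (\<Union>{A\<in>P. A \<subseteq> K}) = (\<Sum>A\<in>{A\<in>P. A \<subseteq> K}. ?m A)"
        using P(1,2) fm by (intro sum_measure_partition) (auto simp: disjoint_def)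
      ultimately show ?thesis by (simp add: k_def)
    qed
    have I: "I > 0" using pos by (simp add: I_def)
    \<comment> \<open>Points of \<open>F\<close> carry weight 1; the sample point of a piece \<open>A\<close> carries weight \<open>- m(A) / I\<close>.
      The factor \<open>1 / I\<close> is nearly optimal when \<open>card F I\<close> is close to \<open>m(W)\<close>.\<close>
    let ?x = "case_sum (\<lambda>x. x) a"
    let ?c = "case_sum (\<lambda>x. 1) (\<lambda>A. - (?m A / I))"
    have "0 \<le> (\<Sum>i\<in>F <+> P. \<Sum>j\<in>F <+> P. ?c i * ?c j * f (?x i - ?x j))"
      using F(1) P(1) by (intro positive_definite_form_nonneg[OF f(2)]) simp
    also have "\<dots> = (\<Sum>x\<in>F. \<Sum>y\<in>F. f (x - y)) - (\<Sum>x\<in>F. s x) / I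
        - (\<Sum>A\<in>P. \<Sum>x\<in>F. ?m A * f (a A - x)) / I + (\<Sum>A\<in>P. ?m A * s (a A)) / I\<^sup>2"
      by (simp add: sum.Plus F(1) P(1) sum.distrib s_def sum_negf sum_subtractf sum_distrib_left sum_divide_distrib
          power2_eq_square mult_ac)
    also have "(\<Sum>A\<in>P. \<Sum>x\<in>F. ?m A * f (a A - x)) = (\<Sum>x\<in>F. s x)"
      unfolding s_def by (subst sum.swap) (intro sum.cong refl arg_cong2[where f = "(*)"] even)
    finally have form: "0 \<le> (\<Sum>x\<in>F. \<Sum>y\<in>F. f (x - y)) - 2 * (\<Sum>x\<in>F. s x) / I
        + (\<Sum>A\<in>P. ?m A * s (a A)) / I\<^sup>2"
      by simp
    have diag: "(\<Sum>x\<in>F. \<Sum>y\<in>F. f (x - y)) \<le> N"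
    proof -
      have "(\<Sum>x\<in>F. \<Sum>y\<in>F. f (x - y)) \<le> (\<Sum>x\<in>F. \<Sum>y\<in>F. if x = y then 1 else 0)"
        using F(3) f(3) by (intro sum_mono) auto
      also have "\<dots> = N" using F(1) by (simp add: N_def)
      finally show ?thesis .
    qed
    have cross: "N * (I - \<eta> * w) \<le> (\<Sum>x\<in>F. s x)"
    proof -
      have "I - \<eta> * w \<le> s x" if "x \<in> F" for x
      proof -
        have "x \<in> K" "x \<in> W" using that F(2) KW by auto
        then show ?thesis using rs[of x] rK[of x] by linarith
      qed
      then have "(\<Sum>x\<in>F. I - \<eta> * w) \<le> (\<Sum>x\<in>F. s x)" by (rule sum_mono)
      then show ?thesis by (simp add: N_def)
    qed
    have quad: "(\<Sum>A\<in>P. ?m A * s (a A)) \<le> I * k + L * (w - k) + \<eta> * w\<^sup>2"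
    proof -
      have bd: "s (a A) \<le> L + \<eta> * w" "A \<subseteq> K \<Longrightarrow> s (a A) \<le> I + \<eta> * w" if "A \<in> P" for A
      proof -
        have "a A \<in> W" using P(3,5) that by blast
        then show "s (a A) \<le> L + \<eta> * w" using rs[of "a A"] rL[of "a A"] by linarith
        assume "A \<subseteq> K"
        then have "a A \<in> K" using P(5)[OF that] by blast
        then show "s (a A) \<le> I + \<eta> * w" using rs[of "a A"] rK[of "a A"] \<open>a A \<in> W\<close> by linarith
      qed
      have "(\<Sum>A\<in>P. ?m A * s (a A)) \<le> (\<Sum>A\<in>P. ?m A * (L + \<eta> * w) + (if A \<subseteq> K then ?m A * (I - L) else 0))"
      proof (rule sum_mono)
        fix A assume A: "A \<in> P"
        show "?m A * s (a A) \<le> ?m A * (L + \<eta> * w) + (if A \<subseteq> K then ?m A * (I - L) else 0)"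
          using mult_left_mono[OF bd(1)[OF A], of "?m A"] mult_left_mono[OF bd(2)[OF A], of "?m A"]
          by (auto simp: algebra_simps)
      qed
      also have "\<dots> = w * (L + \<eta> * w) + k * (I - L)"
        by (simp add: sum.distrib sum_distrib_right[symmetric] sum_w sum_k[symmetric]
            sum.inter_filter[OF P(1), symmetric])
      finally show ?thesis by (simp add: algebra_simps power2_eq_square)
    qed
    have "0 \<le> N - 2 * (N * (I - \<eta> * w)) / I + (I * k + L * (w - k) + \<eta> * w\<^sup>2) / I\<^sup>2"
    proof -
      have "2 * (N * (I - \<eta> * w)) / I \<le> 2 * (\<Sum>x\<in>F. s x) / I"
        using cross I by (intro divide_right_mono) auto
      moreover have "(\<Sum>A\<in>P. ?m A * s (a A)) / I\<^sup>2 \<le> (I * k + L * (w - k) + \<eta> * w\<^sup>2) / I\<^sup>2"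
        using quad by (intro divide_right_mono) auto
      ultimately show ?thesis using form diag by linarith
    qed
    then have "0 \<le> (N - 2 * (N * (I - \<eta> * w)) / I + (I * k + L * (w - k) + \<eta> * w\<^sup>2) / I\<^sup>2) * I\<^sup>2"
      by simp
    also have "\<dots> = - N * I\<^sup>2 + 2 * N * \<eta> * w * I + (I * k + L * (w - k) + \<eta> * w\<^sup>2)"
      using I by (simp add: field_simps power2_eq_square)
    finally show ?thesis by (simp add: algebra_simps)
  qed
  have B: "0 \<le> 2 * N * I * w + w\<^sup>2" (is "0 \<le> ?B")
    using pos by (simp add: N_def I_def w_def)
  have "N * I\<^sup>2 \<le> I * k + L * (w - k)"
  proof (rule field_le_epsilon)
    fix e :: real assume "e > 0"
    then have "e / (?B + 1) * ?B \<le> e" using B by (simp add: field_simps)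
    moreover have "e / (?B + 1) > 0" using \<open>e > 0\<close> B by simp
    ultimately show "N * I\<^sup>2 \<le> I * k + L * (w - k) + e" using approx by fastforce
  qed
  then show ?thesis by (simp add: N_def I_def k_def L_def w_def W_def)
qed

section \<open>Averaging over translates\<close>

text \<open>
  Integrate \<open>y \<mapsto> card (F \<inter> (y + K))\<close>: by symmetry of \<open>K\<close> it is the sum of the indicators of
  \<open>x + K\<close> over \<open>x \<in> F\<close>, and it vanishes outside \<open>F + K\<close>.
\<close>
lemma card_mult_measure_le:
  fixes M :: "'a::{topological_ab_group_add, t2_space} measure"
  assumes M: "haar_measure M" and K: "compact K" "uminus ` K = K" and F: "finite F"
    and B: "\<And>x. real (card (F \<inter> (+) x ` K)) \<le> B"
  shows "card F * measure M K \<le> B * measure M (F + K)"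
proof -
  have cpt: "compact ((+) x ` K)" for x
    by (intro compact_continuous_image continuous_intros K(1))
  have fm: "(+) x ` K \<in> fmeasurable M" for x by (rule haar_compact_fmeasurable[OF M cpt])
  have "compact F" using F by (rule finite_imp_compact)
  then have fFK: "F + K \<in> fmeasurable M"
    by (intro haar_compact_fmeasurable[OF M] compact_set_plus K(1))
  have ind: "integrable M (indicat_real A)" if "A \<in> fmeasurable M" for A
    using that by (intro integrable_real_indicator) (auto simp: fmeasurable_def)
  have "card F * measure M K = (\<Sum>x\<in>F. measure M ((+) x ` K))"
    using haar_measure_translate[OF M] haar_compact_fmeasurable[OF M K(1)] by simp
  also have "\<dots> = (\<integral>y. (\<Sum>x\<in>F. indicat_real ((+) x ` K) y) \<partial>M)"
    using fm ind by (subst Bochner_Integration.integral_sum) (auto simp: fmeasurableD)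
  also have "\<dots> \<le> (\<integral>y. B * indicat_real (F + K) y \<partial>M)"
  proof (rule integral_mono)
    show "integrable M (\<lambda>y. \<Sum>x\<in>F. indicat_real ((+) x ` K) y)"
      using fm ind by (intro Bochner_Integration.integrable_sum) simp
    show "integrable M (\<lambda>y. B * indicat_real (F + K) y)"
      using fFK ind by (intro integrable_mult_right) simp
    fix y
    have mem: "y \<in> (+) x ` K \<longleftrightarrow> x \<in> (+) y ` K" for x
    proof -
      have "z \<in> (+) u ` K \<longleftrightarrow> z - u \<in> K" for z u by (force simp: image_iff)
      moreover have "z \<in> K \<Longrightarrow> - z \<in> K" for z using K(2) by blast
      ultimately show ?thesis by (metis (no_types) minus_diff_eq)
    qed
    have "(\<Sum>x\<in>F. indicat_real ((+) x ` K) y) = card (F \<inter> (+) y ` K)"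
      using F by (simp add: indicator_def mem sum.If_cases Int_def)
    moreover have "F \<inter> (+) y ` K = {}" if "y \<notin> F + K"
    proof (rule ccontr)
      assume "F \<inter> (+) y ` K \<noteq> {}"
      then obtain x where "x \<in> F" "y \<in> (+) x ` K" using mem by blast
      then have "y \<in> F + K" by (auto intro: set_plus_intro)
      with that show False ..
    qed
    ultimately show "(\<Sum>x\<in>F. indicat_real ((+) x ` K) y) \<le> B * indicat_real (F + K) y"
      using B[of y] by (cases "y \<in> F + K") auto
  qed
  also have "\<dots> = B * measure M (F + K)" using fFK by (simp add: fmeasurableD)
  finally show ?thesis .
qed

lemma supp_subset: "{x. f x \<noteq> 0} \<subseteq> supp f"
  unfolding supp_def by (rule closure_subset)

text \<open>The compact set \<open>K\<close> depends on \<open>f\<close> and \<open>\<epsilon>\<close>, but not on \<open>F\<close>.\<close>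
lemma delsarte_packing_bound:
  fixes M :: "'a::{topological_ab_group_add, t2_space} measure"
  assumes M: "haar_measure M" and f: "f \<in> admissible \<Omega> UNIV"
    and \<Lambda>: "\<Omega> \<inter> difference_set \<Lambda> = {0}"
    and pos: "(\<integral>x. f x \<partial>M) > 0" and "\<epsilon> > 0"
  obtains K where "compact K"
    "\<And>F. finite F \<Longrightarrow> F \<subseteq> \<Lambda> \<Longrightarrow> card F * (\<integral>x. f x \<partial>M) \<le> (1 + \<epsilon>) * measure M (F + K)"
proof -
  define I where "I = (\<integral>x. f x \<partial>M)"
  define L where "L = (\<integral>x. \<bar>f x\<bar> \<partial>M)"
  have I: "I > 0" using pos by (simp add: I_def)
  have cont: "continuous_on UNIV f" and pd: "positive_definite f" and f0: "f 0 = 1"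
    and cp: "compact (supp (\<lambda>x. max (f x) 0))" and sub: "supp (\<lambda>x. max (f x) 0) \<subseteq> \<Omega>"
    and cm: "compact (supp (\<lambda>x. max (- f x) 0))"
    using f unfolding admissible_def by simp_all
  define T where "T = supp (\<lambda>x. max (f x) 0) \<union> supp (\<lambda>x. max (- f x) 0)"
  define S where "S = T \<union> uminus ` T"
  have nz: "{x. f x \<noteq> 0} \<subseteq> S"
  proof
    fix x assume "x \<in> {x. f x \<noteq> 0}"
    then consider "max (f x) 0 \<noteq> 0" | "max (- f x) 0 \<noteq> 0" by fastforce
    then have "x \<in> T"
    proof cases
      case 1
      then show ?thesis
        unfolding T_def by (intro UnI1 subsetD[OF supp_subset]) simp
    next
      case 2
      then show ?thesis
        unfolding T_def by (intro UnI2 subsetD[OF supp_subset]) simp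
    qed
    then show "x \<in> S" by (simp add: S_def)
  qed
  have cS: "compact S"
    unfolding S_def T_def by (intro compact_Un compact_uminus_image cp cm)
  have symS: "uminus ` S = S" by (auto simp: S_def image_Un image_image)
  have "open {x. f x \<noteq> 0}" by (intro open_Collect_neq cont continuous_intros)
  then have S0: "0 \<in> interior S" using nz f0 by (auto simp: interior_def)
  have int: "integrable M f" by (rule integrable_continuous_compact_support[OF M cont cS nz])
  have "I \<le> L" unfolding I_def L_def using int by (intro integral_mono) auto
  with I have L: "L > 0" by simp
  have "measure M S > 0"
  proof (rule ccontr)
    assume "\<not> measure M S > 0"
    then have null: "emeasure M S = 0"
      using haar_compact_fmeasurable[OF M cS] by (simp add: emeasure_eq_measure2 zero_less_measure_iff)
    have "AE x in M. f x = 0"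
      by (rule AE_I'[of S]) (use null haar_compact_fmeasurable[OF M cS] nz in \<open>auto simp: null_sets_def fmeasurable_def\<close>)
    then have "I = (\<integral>x. 0 \<partial>M)" unfolding I_def using int by (intro integral_cong_AE) auto
    with I show False by simp
  qed
  \<comment> \<open>With \<open>\<delta> = \<epsilon> I / L\<close> the boundary term \<open>L (m(K + S) - m(K))\<close> is at most \<open>\<epsilon> I m(K)\<close>.\<close>
  moreover have "\<epsilon> * I / L > 0" using I L \<open>\<epsilon> > 0\<close> by simp
  ultimately obtain K where K: "compact K" "uminus ` K = K" "measure M K > 0"
    "measure M (K + S) \<le> (1 + \<epsilon> * I / L) * measure M K"
    by (rule folner_compact[OF M cS S0 symS]) (rule that)
  let ?k = "measure M K"
  have off: "f (x - y) \<le> 0" if "x \<in> \<Lambda>" "y \<in> \<Lambda>" "x \<noteq> y" for x y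
  proof (rule ccontr)
    assume "\<not> f (x - y) \<le> 0"
    then have "x - y \<in> supp (\<lambda>x. max (f x) 0)" using supp_subset[of "\<lambda>x. max (f x) 0"] by auto
    with sub have "x - y \<in> \<Omega>" by blast
    moreover have "x - y \<in> difference_set \<Lambda>" using that by (auto simp: difference_set_def)
    ultimately have "x - y \<in> \<Omega> \<inter> difference_set \<Lambda>" by (rule IntI)
    then have "x - y = 0" by (simp only: \<Lambda> singleton_iff)
    with that(3) show False by simp
  qed
  have "card F * I \<le> (1 + \<epsilon>) * measure M (F + K)" if F: "finite F" "F \<subseteq> \<Lambda>" for F
  proof -
    have "real (card (F \<inter> (+) x ` K)) \<le> (1 + \<epsilon>) * ?k / I" for x
    proof -
      let ?F = "(\<lambda>y. y - x) ` (F \<inter> (+) x ` K)"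
      have "card ?F * I\<^sup>2 \<le> I * ?k + L * (measure M (K + S) - ?k)"
        unfolding I_def L_def
      proof (rule packing_in_compact[OF M cont pd f0 cS _ nz K(1) _ _ _ pos])
        show "0 \<in> S" using S0 interior_subset by blast
        show "f (u - v) \<le> 0" if "u \<in> ?F" "v \<in> ?F" "u \<noteq> v" for u v
        proof -
          have "x + u \<in> \<Lambda>" "x + v \<in> \<Lambda>" "x + u \<noteq> x + v" using that F(2) by auto
          then show ?thesis using off[of "x + u" "x + v"] by simp
        qed
      qed (use F in auto)
      also have "\<dots> \<le> I * ?k + L * (\<epsilon> * I / L * ?k)"
        using K(4) L by (intro add_left_mono mult_left_mono) (auto simp: algebra_simps)
      also have "\<dots> = (1 + \<epsilon>) * ?k * I" using L by (simp add: algebra_simps)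
      finally have "card ?F * I * I \<le> (1 + \<epsilon>) * ?k * I" by (simp add: power2_eq_square mult_ac)
      then have "card ?F * I \<le> (1 + \<epsilon>) * ?k" using I by simp
      moreover have "card ?F = card (F \<inter> (+) x ` K)" by (intro card_image inj_onI) simp
      ultimately show ?thesis using I by (simp add: le_divide_eq)
    qed
    from card_mult_measure_le[OF M K(1,2) F(1) this]
    have "card F * ?k \<le> (1 + \<epsilon>) * ?k / I * measure M (F + K)" .
    then have "(card F * I) * ?k \<le> ((1 + \<epsilon>) * measure M (F + K)) * ?k"
      using I by (simp add: field_simps)
    then show ?thesis using K(3) by simp
  qed
  with K(1) show ?thesis by (intro that[of K]) (auto simp: I_def)
qed

section \<open>The density bound\<close>

text \<open>The case \<open>c = 0\<close> forces \<open>a = 0\<close> and relies on the convention \<open>0 / 0 = 0\<close>.\<close>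
lemma ennreal_divide_le_of_le_mult:
  fixes a b c :: ennreal
  assumes "a \<le> b * c"
  shows "a / c \<le> b"
  using assms
  by (cases "c = 0") (auto intro: divide_le_posI_ennreal simp: zero_less_iff_neq_zero mult.commute)

lemma upper_density_le:
  fixes M :: "'a::{topological_ab_group_add, t2_space} measure"
  assumes M: "haar_measure M" and K: "compact K" and "c \<ge> 0"
    and bound: "\<And>F. finite F \<Longrightarrow> F \<subseteq> \<Lambda> \<Longrightarrow> card F \<le> c * measure M (F + K)"
  shows "upper_density M \<Lambda> \<le> ennreal c"
  unfolding upper_density_def
proof (rule INF_lower2[of K])
  show "K \<in> {C. compact C}" using K by simp
  show "(SUP V\<in>{V. V \<in> sets borel \<and> compact (closure V)}.
      emeasure (count_space UNIV) (\<Lambda> \<inter> V) / outer_measure_of M (K + V)) \<le> ennreal c"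
  proof (intro SUP_least ennreal_divide_le_of_le_mult)
    fix V :: "'a set"
    let ?o = "outer_measure_of M (K + V)"
    have fin: "of_nat (card F) \<le> ennreal c * ?o" if "finite F" "F \<subseteq> \<Lambda> \<inter> V" for F
    proof -
      have "compact (F + K)" using that(1) by (intro compact_set_plus finite_imp_compact K)
      then have fm: "F + K \<in> fmeasurable M" by (rule haar_compact_fmeasurable[OF M])
      have "of_nat (card F) = ennreal (real (card F))" by (rule ennreal_of_nat_eq_real_of_nat)
      also have "\<dots> \<le> ennreal (c * measure M (F + K))"
        using bound that by (intro ennreal_leI) auto
      also have "\<dots> = ennreal c * outer_measure_of M (F + K)"
        using fm \<open>c \<ge> 0\<close> by (simp add: ennreal_mult emeasure_eq_measure2 fmeasurableD)
      also have "\<dots> \<le> ennreal c * ?o"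
      proof (intro mult_left_mono outer_measure_of_mono)
        show "F + K \<subseteq> K + V" using set_plus_mono2[of F V K K] that(2) by (simp add: add.commute)
      qed simp
      finally show ?thesis .
    qed
    show "emeasure (count_space UNIV) (\<Lambda> \<inter> V) \<le> ennreal c * ?o"
    proof (cases "finite (\<Lambda> \<inter> V)")
      case True
      then show ?thesis using fin[of "\<Lambda> \<inter> V"] by simp
    next
      case False
      \<comment> \<open>Arbitrarily large finite subsets force the right hand side to be infinite.\<close>
      have "of_nat n \<le> ennreal c * ?o" for n
      proof -
        obtain F where "finite F" "card F = n" "F \<subseteq> \<Lambda> \<inter> V"
          using infinite_arbitrarily_large[OF False] by blast
        then show ?thesis using fin[of F] by simp
      qed
      then have "\<not> ennreal c * ?o < top"
        using ennreal_Ex_less_of_nat by (auto simp flip: not_le)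
      then have "ennreal c * ?o = top" by (simp only: less_top[symmetric] not_not)
      then show ?thesis by simp
    qed
  qed
qed

theorem theorem1p1:
  fixes M :: "'a::{topological_ab_group_add, t2_space} measure"
    and \<Omega> \<Lambda> :: "'a set"
  assumes "locally_compact_space (euclidean :: 'a topology)"
    and "haar_measure M"
    and "open \<Omega>"
    and "0 \<in> \<Omega>"
    and "uminus ` \<Omega> = \<Omega>"
    and "\<Omega> \<inter> difference_set \<Lambda> = {0}"
  shows "delsarte M \<Omega> \<le> enn2ereal (1 / upper_density M \<Lambda>)"
proof -
  have "ereal (\<integral>x. f x \<partial>M) \<le> enn2ereal (1 / upper_density M \<Lambda>)" if f: "f \<in> admissible \<Omega> UNIV" for f
  proof (cases "(\<integral>x. f x \<partial>M) > 0")
    case False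
    then have "ereal (\<integral>x. f x \<partial>M) \<le> 0" by simp
    then show ?thesis using enn2ereal_nonneg order_trans by blast
  next
    case True
    let ?I = "\<integral>x. f x \<partial>M"
    have "upper_density M \<Lambda> \<le> ennreal (1 / ?I)"
    proof (rule ennreal_le_epsilon)
      fix e :: real assume "e > 0"
      then have "e * ?I > 0" using True by simp
      then obtain K where K: "compact K"
        "\<And>F. finite F \<Longrightarrow> F \<subseteq> \<Lambda> \<Longrightarrow> card F * ?I \<le> (1 + e * ?I) * measure M (F + K)"
        using delsarte_packing_bound[OF assms(2) f assms(6) True] by blast
      have "upper_density M \<Lambda> \<le> ennreal (1 / ?I + e)"
      proof (rule upper_density_le[OF assms(2) K(1)])
        show "card F \<le> (1 / ?I + e) * measure M (F + K)" if "finite F" "F \<subseteq> \<Lambda>" for F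
          using K(2)[OF that] True by (simp add: field_simps)
      qed (use \<open>e > 0\<close> True in simp)
      then show "upper_density M \<Lambda> \<le> ennreal (1 / ?I) + ennreal e"
        using \<open>e > 0\<close> True by simp
    qed
    then have "ennreal ?I \<le> 1 / upper_density M \<Lambda>"
    proof (cases "upper_density M \<Lambda>")
      case (real d)
      show ?thesis
      proof (cases "d = 0")
        case False
        with real \<open>upper_density M \<Lambda> \<le> ennreal (1 / ?I)\<close> True have d: "d > 0" "d \<le> 1 / ?I" by auto
        then have "?I \<le> 1 / d" using True by (simp add: field_simps)
        then have "ennreal ?I \<le> ennreal (1 / d)" by (rule ennreal_leI)
        also have "\<dots> = 1 / ennreal d" using d(1) divide_ennreal[of 1 d] by simp
        finally show ?thesis using real by simp
      qed (use real in simp)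
    qed (simp add: top_unique)
    then have "enn2ereal (ennreal ?I) \<le> enn2ereal (1 / upper_density M \<Lambda>)"
      by (simp only: less_eq_ennreal.rep_eq)
    then show ?thesis using True by (simp only: enn2ereal_ennreal less_imp_le)
  qed
  then show ?thesis by (auto simp: delsarte_def intro: SUP_least)
qed

end
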